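(* Let $5 \le p \le q \le \binom{p+1}{\lfloor \frac{p+1}{2} \rfloor} - 1$. Then $f(K(3,p,q)) = 2$.
   Context: $K(3,p,q)$ is the complete tripartite graph with parts of sizes $3$, $p$, $q$. A strong orientation of a graph is an orientation of all edges making the digraph strongly connected; the diameter of a strongly connected digraph is the maximum directed distance between ordered pairs of vertices. The oriented diameter $f(G)$ is the minimum diameter over all strong orientations of $G$. *)

theory Defs
  imports "Graph_Theory.Graph_Theory" "HOL-Library.Extended_Nat" "HOL-Library.Extended_Real"
begin

text \<open>
  As in \<^theory>\<open>Graph_Theory.Graph_Theory\<close>, a simple undirected graph is a symmetric loop-free
  digraph: an edge \<open>uv\<close> is the pair of opposite arcs \<open>(u, v)\<close>, \<open>(v, u)\<close>.
\<close>

text \<open>The three-part analogue of \<^const>\<open>complete_bipartite_digraph\<close>.\<close>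

definition complete_tripartite_digraph ::
  "nat \<Rightarrow> nat \<Rightarrow> nat \<Rightarrow> ('a, 'b) pre_digraph \<Rightarrow> bool" where
  "complete_tripartite_digraph l m n G \<longleftrightarrow> graph G \<and>
    (\<exists>U V W. verts G = U \<union> V \<union> W \<and> U \<inter> V = {} \<and> U \<inter> W = {} \<and> V \<inter> W = {}
      \<and> card U = l \<and> card V = m \<and> card W = n
      \<and> arcs_ends G = U \<times> V \<union> V \<times> U \<union> U \<times> W \<union> W \<times> U \<union> V \<times> W \<union> W \<times> V)"

text \<open>
  \<open>D\<close> is an orientation of \<open>G\<close> if its underlying undirected graph is \<open>G\<close> and no edge
  is present in both directions.
\<close>

definition orientation :: "'a pair_pre_digraph \<Rightarrow> 'a pair_pre_digraph \<Rightarrow> bool" where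
  "orientation D G \<longleftrightarrow> mk_symmetric (with_proj D) = G \<and> asym (parcs D)"

definition strong_orientation :: "'a pair_pre_digraph \<Rightarrow> 'a pair_pre_digraph \<Rightarrow> bool" where
  "strong_orientation D G \<longleftrightarrow> orientation D G \<and> strongly_connected (with_proj D)"

text \<open>Directed distance; it is \<open>\<infinity>\<close> if there is no walk from \<open>u\<close> to \<open>v\<close>.\<close>

definition ddist :: "('a, 'b) pre_digraph \<Rightarrow> 'a \<Rightarrow> 'a \<Rightarrow> enat" where
  "ddist G u v = (INF p \<in> {p. pre_digraph.awalk G u p v}. enat (length p))"

definition diameter :: "('a, 'b) pre_digraph \<Rightarrow> enat" where
  "diameter G = (SUP u \<in> verts G. SUP v \<in> verts G. ddist G u v)"

text \<open>
  Infima of nonempty sets of type \<^typ>\<open>enat\<close> are attained, so this is a minimum whenever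
  \<open>G\<close> has a strong orientation; otherwise the value is \<open>\<infinity>\<close>.
\<close>

definition oriented_diameter :: "'a pair_pre_digraph \<Rightarrow> enat" where
  "oriented_diameter G = (INF D \<in> {D. strong_orientation D G}. diameter (with_proj D))"

lemma orientation_iff:
  assumes "pair_graph G"
  shows "orientation D G \<longleftrightarrow> pverts D = pverts G \<and> parcs D \<subseteq> parcs G \<and>
    (\<forall>(u, v) \<in> parcs G. ((u, v) \<in> parcs D) \<noteq> ((v, u) \<in> parcs D))"
proof -
  interpret pair_graph G by (rule assms)
  have symG: "(v, u) \<in> parcs G" if "(u, v) \<in> parcs G" for u v
    using that pair_sym_arcs by (auto simp: symmetric_def dest: symD)
  have un: "(\<Union>e\<in>R. {(fst e, snd e), (snd e, fst e)}) = R \<union> R\<inverse>" for R :: "'a rel"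
    by force
  have mk: "mk_symmetric (with_proj D) = \<lparr>pverts = pverts D, parcs = parcs D \<union> (parcs D)\<inverse>\<rparr>"
    unfolding mk_symmetric_def with_proj_simps un ..
  have eq: "mk_symmetric (with_proj D) = G \<longleftrightarrow> pverts D = pverts G \<and>
      (\<forall>u v. (u, v) \<in> parcs G \<longleftrightarrow> (u, v) \<in> parcs D \<or> (v, u) \<in> parcs D)"
    unfolding mk by (cases G) (auto simp: set_eq_iff)
  have as: "asym (parcs D) \<longleftrightarrow> (\<forall>u v. (u, v) \<in> parcs D \<longrightarrow> (v, u) \<notin> parcs D)"
    by (meson asymD asymI)
  show ?thesis
    unfolding orientation_def eq as subset_eq using symG by fastforce
qed

lemma (in wf_digraph) ereal_of_enat_ddist: "ereal_of_enat (ddist G u v) = \<mu> (\<lambda>_. 1) u v"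
proof -
  have cost: "awalk_cost (\<lambda>_. 1) p = real (length p)" for p
    by (induction p) auto
  show ?thesis
  proof (cases "{p. awalk u p v} = {}")
    case True
    then show ?thesis by (simp add: ddist_def \<mu>_def top_enat_def top_ereal_def)
  next
    case False
    then have "(\<lambda>p. enat (length p)) ` {p. awalk u p v} \<noteq> {}" by simp
    then have "ddist G u v \<in> (\<lambda>p. enat (length p)) ` {p. awalk u p v}"
      unfolding ddist_def by (metis (lifting) Inf_enat_def LeastI equals0I)
    then obtain p where p: "awalk u p v" "ddist G u v = enat (length p)" by auto
    have "enat (length p) \<le> enat (length r)" if "awalk u r v" for r
      unfolding p(2)[symmetric] ddist_def using that by (auto intro: INF_lower)
    with p show ?thesis
      unfolding \<mu>_def by (intro antisym INF_greatest INF_lower2[of p]) (auto simp: cost)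
  qed
qed

lemma oriented_diameter_attained:
  assumes "strong_orientation D0 G"
  shows "\<exists>D. strong_orientation D G \<and> diameter (with_proj D) = oriented_diameter G"
proof -
  let ?S = "(\<lambda>D. diameter (with_proj D)) ` {D. strong_orientation D G}"
  have "?S \<noteq> {}" using assms by blast
  then have "Inf ?S \<in> ?S" by (metis (lifting) Inf_enat_def LeastI equals0I)
  then show ?thesis by (auto simp: oriented_diameter_def)
qed

lemma complete_tripartite_digraph_exists:
  "\<exists>G :: nat pair_pre_digraph. complete_tripartite_digraph l m n (with_proj G)"
proof -
  let ?U = "{..<l}" and ?V = "{l..<l+m}" and ?W = "{l+m..<l+m+n}"
  let ?G = "\<lparr>pverts = ?U \<union> ?V \<union> ?W,
     parcs = ?U \<times> ?V \<union> ?V \<times> ?U \<union> ?U \<times> ?W \<union> ?W \<times> ?U \<union> ?V \<times> ?W \<union> ?W \<times> ?V\<rparr>"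
  interpret pair_graph ?G
    by unfold_locales (auto simp: symmetric_def intro!: symI)
  have parts: "?U \<inter> ?V = {}" "?U \<inter> ?W = {}" "?V \<inter> ?W = {}" "card ?U = l" "card ?V = m" "card ?W = n"
    by auto
  have "complete_tripartite_digraph l m n (with_proj ?G)"
    unfolding complete_tripartite_digraph_def with_proj_simps pair_pre_digraph.simps
    by (intro conjI pair_graphD_graph exI[of _ ?U] exI[of _ ?V] exI[of _ ?W] parts refl)
  then show ?thesis ..
qed

end

(*
  Let {x1, x2, x3}, V, W be the parts, put k = (p + 1) div 2 and identify V with {0..<p}. Orient
  x1 -> V -> x3 -> W -> x1, let x2 dominate exactly the k vertices {0..<k} of V, and let the
  out-neighbourhoods of the vertices of W in V \<union> {x2} be distinct k-subsets. These form an
  antichain, so any two vertices of W are at distance at most 2 in both directions. The only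
  k-subset that does not work is {0..<k}: such a vertex would have no path of length 2 to x2.
  This leaves (p + 1 choose k) - 1 admissible subsets. All remaining distance conditions hold as
  soon as the chosen family contains p specific sets, namely the cyclic intervals of length k in
  {0..<p} other than {0..<k}, and one set containing x2 and disjoint from {0..<k}.
*)

theory Submission
  imports Defs "HOL-Number_Theory.Cong"
begin

section \<open>Rotations and cyclic intervals modulo \<open>p\<close>\<close>

lemma mod_add_inj_on: "inj_on (\<lambda>t. (t + i) mod p) {..<p::nat}"
proof (rule inj_onI)
  fix x y assume xy: "x \<in> {..<p}" "y \<in> {..<p}" and "(x + i) mod p = (y + i) mod p"
  then have "[x + i = y + i] (mod p)" by (simp add: cong_def)
  then have "[x = y] (mod p)" by (simp only: cong_add_rcancel_nat)
  then show "x = y" using xy by (simp add: cong_def)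
qed

text \<open>An arc of \<open>k\<close> consecutive residues starting at \<open>i\<close>. Writing it
  as an image of the offsets \<open>t\<close> reduces size and membership to injectivity of the
  rotation by \<open>i\<close>.\<close>

definition cyclic_interval :: "nat \<Rightarrow> nat \<Rightarrow> nat \<Rightarrow> nat set" where
  "cyclic_interval p k i = (\<lambda>t. (t + i) mod p) ` {..<k}"

lemma cyclic_interval_subset: "0 < p \<Longrightarrow> cyclic_interval p k i \<subseteq> {..<p}"
  by (auto simp: cyclic_interval_def)

lemma card_cyclic_interval: "k \<le> p \<Longrightarrow> card (cyclic_interval p k i) = k"
  unfolding cyclic_interval_def
  by (subst card_image) (auto intro: inj_on_subset[OF mod_add_inj_on])

lemma cyclic_interval_0: "k \<le> p \<Longrightarrow> cyclic_interval p k 0 = {..<k}"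
  by (auto simp: cyclic_interval_def image_iff)

lemma mod_add_in_cyclic_interval_iff:
  assumes "t < p" "k \<le> p"
  shows "(t + i) mod p \<in> cyclic_interval p k i \<longleftrightarrow> t < k"
  unfolding cyclic_interval_def
  using inj_on_image_mem_iff[OF mod_add_inj_on, of t p "{..<k}" i] assms by auto

text \<open>A point lies in the interval iff its offset from the start \<open>i\<close> is below
  \<open>k\<close>. So it suffices to choose the start such that \<open>v\<close> has an offset
  below \<open>k\<close> and \<open>u\<close>, which lies \<open>d\<close> steps further on, an
  offset in \<open>{k..<p}\<close>.\<close>

lemma cyclic_interval_separates:
  assumes "u < p" "v < p" "u \<noteq> v" "0 < k" "k < p"
  shows "\<exists>i<p. u \<notin> cyclic_interval p k i \<and> v \<in> cyclic_interval p k i"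
proof -
  obtain d where d: "0 < d" "d < p" "(v + d) mod p = u"
  proof (cases "v < u")
    case True
    with assms that[of "u - v"] show ?thesis by auto
  next
    case False
    with assms that[of "p - (v - u)"] show ?thesis by auto
  qed
  \<comment> \<open>\<open>t\<close> is the desired offset of \<open>v\<close>. Either
    \<open>v\<close> is the last point of the interval (\<open>k - 1\<close>), or, if
    \<open>u\<close> would then wrap around past the end, \<open>u\<close> gets the last offset
    \<open>p - 1\<close>.\<close>
  obtain t where t: "t < k" "k \<le> t + d" "t + d < p"
    using d(1,2) assms that[of "k - 1"] that[of "p - 1 - d"] by (cases "d \<le> p - k") auto
  \<comment> \<open>This is \<open>v - t\<close> modulo \<open>p\<close>; the summand
    \<open>p\<close> avoids truncated subtraction.\<close>
  define i where "i = (v + p - t) mod p"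
  have vi: "(t + i) mod p = v"
    using t assms by (simp add: i_def mod_simps)
  moreover have "(t + d + i) mod p = u"
  proof -
    have "(t + d + i) mod p = ((t + i) mod p + d) mod p" by (simp add: mod_simps ac_simps)
    then show ?thesis using vi d(3) by simp
  qed
  moreover have "i < p" using assms by (simp add: i_def)
  ultimately show ?thesis
    using mod_add_in_cyclic_interval_iff[of t p k i] mod_add_in_cyclic_interval_iff[of "t + d" p k i]
      t assms(5) by (intro exI[of _ i]) simp
qed

section \<open>A family of \<open>q\<close> sets of size \<open>k\<close> with the required
  separation properties\<close>

text \<open>The point \<open>p\<close> of the ground set \<open>{..p}\<close> plays the role of \<open>x2\<close>, the others that of \<open>V\<close>.\<close>

lemma separating_family:
  fixes p q :: nat
  defines "k \<equiv> (p + 1) div 2"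
  assumes "2 \<le> p" "p \<le> q" "q \<le> ((p + 1) choose k) - 1"
  obtains F where "finite F" "card F = q"
    "\<And>X. X \<in> F \<Longrightarrow> X \<subseteq> {..p} \<and> card X = k \<and> X \<noteq> {..<k}"
    "\<And>u v. u < p \<Longrightarrow> v < p \<Longrightarrow> u \<noteq> v \<Longrightarrow> u < k \<or> k \<le> v \<Longrightarrow> \<exists>X\<in>F. u \<notin> X \<and> v \<in> X"
    "\<And>v. k \<le> v \<Longrightarrow> v < p \<Longrightarrow> \<exists>X\<in>F. p \<notin> X \<and> v \<in> X"
    "\<exists>X\<in>F. p \<in> X \<and> X \<inter> {..<k} = {}"
proof -
  have k: "0 < k" "k < p" "2 * k - 1 \<le> p" using assms by (auto simp: k_def)
  define L where "L = {X. X \<subseteq> {..p} \<and> card X = k} - {{..<k}}"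
  have L: "finite L" "card L = ((p + 1) choose k) - 1"
  proof -
    have "{..<k} \<in> {X. X \<subseteq> {..p} \<and> card X = k}" using k by auto
    then show "finite L" "card L = ((p + 1) choose k) - 1"
      by (simp_all add: L_def card_Diff_singleton n_subsets)
  qed
  \<comment> \<open>The set containing \<open>x2\<close> and disjoint from \<open>{..<k}\<close>.
    The bound \<open>2 * k - 1 \<le> p\<close> keeps the other \<open>k - 1\<close> elements below
    \<open>p\<close>.\<close>
  define Y where "Y = insert p {k..<2 * k - 1}"
  define C where "C = insert Y (cyclic_interval p k ` {1..<p})"
  have "card Y = k" using k by (simp add: Y_def)
  moreover have "p \<in> Y" "p \<notin> {..<k}" "Y \<subseteq> {..p}" using k by (auto simp: Y_def)
  ultimately have "Y \<in> L" unfolding L_def by blast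
  have ne: "cyclic_interval p k i \<noteq> {..<k}" if "i \<in> {1..<p}" for i
  proof
    assume eq: "cyclic_interval p k i = {..<k}"
    \<comment> \<open>The point 0 has offset \<open>p - i\<close> and the point \<open>p - 1\<close>
      has offset \<open>p - i - 1\<close>. The set \<open>{..<k}\<close> contains the former but not
      the latter, which would give \<open>p - i < k \<le> p - i - 1\<close>.\<close>
    have "(p - i + i) mod p \<in> cyclic_interval p k i" using eq k that by simp
    then have "p - i < k" using k that by (subst (asm) mod_add_in_cyclic_interval_iff) auto
    moreover have "(p - i - 1 + i) mod p \<notin> cyclic_interval p k i"
      using eq k that by simp
    ultimately show False
      using k that by (subst (asm) mod_add_in_cyclic_interval_iff) auto
  qed
  have "cyclic_interval p k i \<in> L" if "i \<in> {1..<p}" for i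
    using k ne[OF that] cyclic_interval_subset[of p k i] card_cyclic_interval[of k p i]
    unfolding L_def by fastforce
  then have "C \<subseteq> L" using \<open>Y \<in> L\<close> unfolding C_def by blast
  \<comment> \<open>At most \<open>p - 1\<close> intervals and \<open>Y\<close>: the
    \<open>p\<close> prescribed sets fit because \<open>p \<le> q\<close>, and the upper bound on
    \<open>q\<close> leaves room in \<open>L\<close> to enlarge \<open>C\<close> to exactly
    \<open>q\<close> sets.\<close>
  have "card C \<le> Suc (card (cyclic_interval p k ` {1..<p}))"
    unfolding C_def by (simp add: card_insert_if)
  also have "\<dots> \<le> Suc (card {1..<p})"
    using card_image_le[of "{1..<p}" "cyclic_interval p k"] by simp
  also have "\<dots> \<le> q" using assms(2,3) by simp
  finally obtain F where F: "C \<subseteq> F" "F \<subseteq> L" "card F = q"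
    using exists_subset_between[of C q L] \<open>C \<subseteq> L\<close> L assms(4) by metis
  show thesis
  proof (rule that[of F])
    show "finite F" "card F = q" using F L finite_subset by auto
    show "X \<subseteq> {..p} \<and> card X = k \<and> X \<noteq> {..<k}" if "X \<in> F" for X
      using that F by (auto simp: L_def)
    show "\<exists>X\<in>F. u \<notin> X \<and> v \<in> X" if "u < p" "v < p" "u \<noteq> v" "u < k \<or> k \<le> v" for u v
    proof -
      obtain i where i: "i < p" "u \<notin> cyclic_interval p k i" "v \<in> cyclic_interval p k i"
        using cyclic_interval_separates \<open>u < p\<close> \<open>v < p\<close> \<open>u \<noteq> v\<close> k by blast
      \<comment> \<open>The interval starting at 0 is the forbidden \<open>{..<k}\<close>. It
        separates only pairs with \<open>k \<le> u\<close> and \<open>v < k\<close>, which the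
        hypothesis excludes.\<close>
      have "i \<noteq> 0"
      proof
        assume "i = 0"
        then have "\<not> u < k" "v < k" using i cyclic_interval_0[of k p] k(2) by simp_all
        then show False using \<open>u < k \<or> k \<le> v\<close> by simp
      qed
      then have "i \<in> {1..<p}" using i(1) by simp
      then have "cyclic_interval p k i \<in> C" unfolding C_def by blast
      then have "cyclic_interval p k i \<in> F" using F(1) by blast
      with i show ?thesis by blast
    qed
    show "\<exists>X\<in>F. p \<notin> X \<and> v \<in> X" if "k \<le> v" "v < p" for v
    proof (rule bexI)
      \<comment> \<open>The witness is the interval that begins at \<open>v\<close>; since
        \<open>v \<ge> k > 0\<close>, it is not the forbidden one.\<close>
      have "v \<in> {1..<p}" using that k by simp
      then have "cyclic_interval p k v \<in> C" unfolding C_def by blast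
      then show "cyclic_interval p k v \<in> F" using F(1) by blast
      have "p \<notin> cyclic_interval p k v" using cyclic_interval_subset[of p k v] k by auto
      moreover have "v \<in> cyclic_interval p k v"
        using that k mod_add_in_cyclic_interval_iff[of 0 p k v] by simp
      ultimately show "p \<notin> cyclic_interval p k v \<and> v \<in> cyclic_interval p k v" ..
    qed
    show "\<exists>X\<in>F. p \<in> X \<and> X \<inter> {..<k} = {}"
    proof (rule bexI)
      show "p \<in> Y \<and> Y \<inter> {..<k} = {}" using k by (auto simp: Y_def)
      show "Y \<in> F" using F(1) by (auto simp: C_def)
    qed
  qed
qed

section \<open>Bounding the diameter by 2 from above and from below\<close>

lemma two_step_distance:
  fixes D :: "'a pair_pre_digraph"
  assumes "parcs D \<subseteq> pverts D \<times> pverts D" "pverts D \<noteq> {}"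
    and two: "\<And>u v. u \<in> pverts D \<Longrightarrow> v \<in> pverts D \<Longrightarrow> u \<noteq> v \<Longrightarrow> (u, v) \<in> parcs D \<union> parcs D O parcs D"
  shows "strongly_connected (with_proj D)" "diameter (with_proj D) \<le> 2"
proof -
  interpret pair_wf_digraph D using assms(1) by unfold_locales auto
  have walk: "\<exists>p. awalk u p v \<and> length p \<le> 2" if "u \<in> pverts D" "v \<in> pverts D" for u v
  proof -
    consider "u = v" | "(u, v) \<in> parcs D" | z where "(u, z) \<in> parcs D" "(z, v) \<in> parcs D"
      using two \<open>u \<in> pverts D\<close> \<open>v \<in> pverts D\<close> by blast
    then show ?thesis
    proof cases
      case 1
      then show ?thesis using that by (intro exI[of _ "[]"]) (simp add: awalk_def)
    next
      case 2
      then show ?thesis using that by (intro exI[of _ "[(u, v)]"]) (simp add: awalk_def)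
    next
      case 3
      then show ?thesis using that by (intro exI[of _ "[(u, z), (z, v)]"]) (simp add: awalk_def)
    qed
  qed
  show "strongly_connected (with_proj D)"
    using walk assms(2) by (auto simp: strongly_connected_def reachable_awalk)
  have "ddist (with_proj D) u v \<le> 2" if uv: "u \<in> pverts D" "v \<in> pverts D" for u v
  proof -
    obtain p where "awalk u p v" "length p \<le> 2" using walk uv by blast
    then show ?thesis unfolding ddist_def
      by (intro INF_lower2[of p]) (auto simp: numeral_eq_enat)
  qed
  then show "diameter (with_proj D) \<le> 2" by (auto simp: diameter_def intro!: SUP_least)
qed

lemma two_le_diameter:
  fixes D :: "'a pair_pre_digraph"
  assumes "u \<in> pverts D" "v \<in> pverts D" "u \<noteq> v" "(u, v) \<notin> parcs D"
  shows "2 \<le> diameter (with_proj D)"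
proof -
  have "2 \<le> length p" if "pre_digraph.awalk (with_proj D) u p v" for p
  proof (rule ccontr)
    assume "\<not> 2 \<le> length p"
    then consider "p = []" | e where "p = [e]"
      by (cases p; cases "tl p") auto
    then show False
      using that assms by cases (auto simp: pre_digraph.awalk_def pre_digraph.cas.simps)
  qed
  then have "2 \<le> ddist (with_proj D) u v"
    unfolding ddist_def by (auto intro!: INF_greatest simp: numeral_eq_enat)
  also have "\<dots> \<le> diameter (with_proj D)"
    unfolding diameter_def using assms
    by (intro SUP_upper2[of u] SUP_upper2[of v]) auto
  finally show ?thesis .
qed

section \<open>From the set family to an orientation of diameter at most 2\<close>

text \<open>\<open>g\<close> numbers \<open>V\<close>, and \<open>h w\<close> encodes the
  out-neighbours of \<open>w\<close> in \<open>V\<close> and \<open>x2\<close>, with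
  \<open>p\<close> standing for \<open>x2\<close>. The family conditions supply midpoints in
  \<open>W\<close>: \<open>sep\<close> for paths inside \<open>V\<close>, \<open>high\<close> for
  paths from \<open>x2\<close> to vertices numbered at least \<open>k\<close>, and
  \<open>low\<close> for paths to \<open>x2\<close> from those numbered below
  \<open>k\<close>.\<close>

lemma strong_orientation_of_family:
  fixes G :: "'a pair_pre_digraph" and g :: "'a \<Rightarrow> nat" and h :: "'a \<Rightarrow> nat set"
  assumes "pair_graph G"
    and verts: "pverts G = {x1, x2, x3} \<union> V \<union> W"
    and x: "distinct [x1, x2, x3]"
    and disj: "{x1, x2, x3} \<inter> V = {}" "{x1, x2, x3} \<inter> W = {}" "V \<inter> W = {}"
    and arcs: "parcs G = {x1, x2, x3} \<times> V \<union> V \<times> {x1, x2, x3} \<union> {x1, x2, x3} \<times> W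
      \<union> W \<times> {x1, x2, x3} \<union> V \<times> W \<union> W \<times> V"
    and g: "bij_betw g V {..<p}" and h: "bij_betw h W F"
    and k: "2 \<le> k" "k + 1 < p"
    and F: "\<And>X. X \<in> F \<Longrightarrow> X \<subseteq> {..p} \<and> card X = k \<and> X \<noteq> {..<k}"
    and sep: "\<And>u v. u < p \<Longrightarrow> v < p \<Longrightarrow> u \<noteq> v \<Longrightarrow> u < k \<or> k \<le> v \<Longrightarrow> \<exists>X\<in>F. u \<notin> X \<and> v \<in> X"
    and high: "\<And>v. k \<le> v \<Longrightarrow> v < p \<Longrightarrow> \<exists>X\<in>F. p \<notin> X \<and> v \<in> X"
    and low: "\<exists>X\<in>F. p \<in> X \<and> X \<inter> {..<k} = {}"
  shows "\<exists>D. strong_orientation D G \<and> diameter (with_proj D) \<le> 2"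
proof -
  define R where "R = {x1} \<times> V \<union> V \<times> {x3} \<union> {x3} \<times> W \<union> W \<times> {x1}
    \<union> {x2} \<times> {v \<in> V. g v < k} \<union> {v \<in> V. k \<le> g v} \<times> {x2}
    \<union> {w \<in> W. p \<in> h w} \<times> {x2} \<union> {x2} \<times> {w \<in> W. p \<notin> h w}
    \<union> {(w, v). w \<in> W \<and> v \<in> V \<and> g v \<in> h w} \<union> {(v, w). v \<in> V \<and> w \<in> W \<and> g v \<notin> h w}"
  define D where "D = \<lparr>pverts = pverts G, parcs = R\<rparr>"
  have R:
    "\<And>v. v \<in> V \<Longrightarrow> (x1, v) \<in> R" "\<And>v. v \<in> V \<Longrightarrow> (v, x3) \<in> R"
    "\<And>v. v \<in> V \<Longrightarrow> g v < k \<Longrightarrow> (x2, v) \<in> R" "\<And>v. v \<in> V \<Longrightarrow> k \<le> g v \<Longrightarrow> (v, x2) \<in> R"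
    "\<And>w. w \<in> W \<Longrightarrow> (x3, w) \<in> R" "\<And>w. w \<in> W \<Longrightarrow> (w, x1) \<in> R"
    "\<And>w. w \<in> W \<Longrightarrow> p \<in> h w \<Longrightarrow> (w, x2) \<in> R" "\<And>w. w \<in> W \<Longrightarrow> p \<notin> h w \<Longrightarrow> (x2, w) \<in> R"
    "\<And>v w. v \<in> V \<Longrightarrow> w \<in> W \<Longrightarrow> g v \<in> h w \<Longrightarrow> (w, v) \<in> R"
    "\<And>v w. v \<in> V \<Longrightarrow> w \<in> W \<Longrightarrow> g v \<notin> h w \<Longrightarrow> (v, w) \<in> R"
    by (auto simp: R_def)
  have gV: "g v < p" if "v \<in> V" for v
    using that g by (auto simp: bij_betw_def)
  have gex: "\<exists>v\<in>V. g v = j" if "j < p" for j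
    using that bij_betw_imp_surj_on[OF g] by (metis imageE lessThan_iff)
  have hW: "h w \<subseteq> {..p}" "card (h w) = k" "h w \<noteq> {..<k}" "finite (h w)" if "w \<in> W" for w
    using that h F[of "h w"] finite_subset[of "h w" "{..p}"] by (auto simp: bij_betw_def)
  have hex: "\<exists>w\<in>W. h w = X" if "X \<in> F" for X
    using that bij_betw_imp_surj_on[OF h] by (metis imageE)
  have sepW: "\<exists>w\<in>W. g u \<notin> h w \<and> g v \<in> h w" if "u \<in> V" "v \<in> V" "u \<noteq> v" "g u < k \<or> k \<le> g v" for u v
  proof -
    have "g u \<noteq> g v" using that g by (auto simp: bij_betw_def dest: inj_onD)
    then show ?thesis using sep[of "g u" "g v"] that gV hex by metis
  qed
  have highW: "\<exists>w\<in>W. p \<notin> h w \<and> g v \<in> h w" if "v \<in> V" "k \<le> g v" for v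
    using high[of "g v"] that gV hex by metis
  \<comment> \<open>Every vertex of \<open>V\<close> numbered below \<open>k\<close> points to
    \<open>w2\<close>, and \<open>w2\<close> points to \<open>x2\<close>.\<close>
  obtain w2 where w2: "w2 \<in> W" "p \<in> h w2" "h w2 \<inter> {..<k} = {}"
    using low hex by metis
  obtain v0 where v0: "v0 \<in> V" "g v0 < k" using gex[of 0] k by auto
  obtain v1 where v1: "v1 \<in> V" "k \<le> g v1" using gex[of k] k by auto
  obtain w1 where w1: "w1 \<in> W" "p \<notin> h w1" using highW[OF v1] by auto
  have omit: "\<exists>w\<in>W. g v \<notin> h w" if "v \<in> V" for v
  proof (cases "g v < k")
    case True
    then show ?thesis using w2 by blast
  next
    case False
    \<comment> \<open>A second vertex numbered at least \<open>k\<close>, available because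
      \<open>k + 1 < p\<close>; for such a target \<open>sepW\<close> applies.\<close>
    obtain u where u: "u \<in> V" "g u = (if g v = k then k + 1 else k)"
      using gex[of k] gex[of "k + 1"] k by (cases "g v = k") auto
    then have "u \<noteq> v" "k \<le> g u" by (auto split: if_splits)
    then show ?thesis using sepW[of v u] u that by blast
  qed
  have hit: "\<exists>w\<in>W. g v \<in> h w" if "v \<in> V" for v
  proof (cases "g v < k")
    case True
    \<comment> \<open>A second vertex numbered below \<open>k\<close>, available because
      \<open>2 \<le> k\<close>; from such a source \<open>sepW\<close> applies.\<close>
    obtain u where u: "u \<in> V" "g u = (if g v = 0 then 1 else 0)"
      using gex[of 0] gex[of "1"] k by (cases "g v = 0") auto
    then have "u \<noteq> v" "g u < k" using k by (auto split: if_splits)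
    then show ?thesis using sepW[of u v] u that by blast
  next
    case False
    then show ?thesis using highW[of v] that by auto
  qed
  have out_low: "\<exists>v\<in>V. g v < k \<and> g v \<notin> h w" if "w \<in> W" "p \<in> h w" for w
  proof (rule ccontr)
    assume "\<not> ?thesis"
    then have "j \<in> h w" if "j < k" for j
      using gex[of j] k that by auto
    then have "{..<k} \<subseteq> h w" by auto
    then have "{..<k} = h w" using hW that by (intro card_subset_eq) auto
    then show False using that hW(3)[of w] by simp
  qed
  \<comment> \<open>The exclusion of \<open>{..<k}\<close> enters here: a \<open>k\<close>-set
    without \<open>p\<close> and without elements in \<open>{k..<p}\<close> would equal it, and
    \<open>w\<close> would have no path of length 2 to \<open>x2\<close>.\<close>
  have in_high: "\<exists>v\<in>V. k \<le> g v \<and> g v \<in> h w" if "w \<in> W" "p \<notin> h w" for w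
  proof (rule ccontr)
    assume neg: "\<not> ?thesis"
    have "j < k" if "j \<in> h w" for j
    proof -
      have "j < p" using that hW(1)[OF \<open>w \<in> W\<close>] \<open>p \<notin> h w\<close> by (metis atMost_iff le_neq_implies_less subsetD)
      then show ?thesis using neg gex[of j] that by (metis not_le)
    qed
    then have "h w \<subseteq> {..<k}" by auto
    then have "h w = {..<k}" using hW that by (intro card_subset_eq) auto
    then show False using that hW by auto
  qed
  have in_any: "\<exists>v\<in>V. g v \<in> h w" if "w \<in> W" for w
  proof -
    have "\<not> h w \<subseteq> {p}" using hW[OF that] k card_mono[of "{p}" "h w"] by auto
    then obtain j where "j \<in> h w" "j \<noteq> p" by auto
    then show ?thesis using hW(1)[OF that] gex[of j] by (metis atMost_iff le_neq_implies_less subsetD)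
  qed
  have out_any: "\<exists>v\<in>V. g v \<notin> h w" if "w \<in> W" for w
  proof -
    have "\<not> {..<p} \<subseteq> h w" using hW[OF that] k card_mono[of "h w" "{..<p}"] by auto
    then show ?thesis using gex by (metis lessThan_iff subsetI)
  qed
  have diffW: "\<exists>z. (w, z) \<in> R \<and> (z, w') \<in> R" if w: "w \<in> W" "w' \<in> W" "w \<noteq> w'" for w w'
  proof -
    have "h w \<noteq> h w'" using w h by (auto simp: bij_betw_def dest: inj_onD)
    \<comment> \<open>Distinct sets of equal size form an antichain. An element \<open>j\<close> of
      the difference names the midpoint: \<open>x2\<close> if \<open>j = p\<close>, otherwise the
      vertex of \<open>V\<close> numbered \<open>j\<close>.\<close>
    then have "\<not> h w \<subseteq> h w'" using w hW card_subset_eq by metis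
    then obtain j where j: "j \<in> h w" "j \<notin> h w'" by auto
    show ?thesis
    proof (cases "j = p")
      case True
      then show ?thesis using j w v0 R by blast
    next
      case False
      then have "j < p" using j hW(1)[OF w(1)] by (metis atMost_iff le_neq_implies_less subsetD)
      then show ?thesis using gex[of j] j w R by metis
    qed
  qed
  have ne: "x1 \<noteq> x2" "x2 \<noteq> x1" "x1 \<noteq> x3" "x3 \<noteq> x1" "x2 \<noteq> x3" "x3 \<noteq> x2"
    using x by auto
  have nonmem: "x1 \<notin> V" "x2 \<notin> V" "x3 \<notin> V" "x1 \<notin> W" "x2 \<notin> W" "x3 \<notin> W"
    using disj by blast+
  have "R \<subseteq> parcs G" unfolding R_def arcs by blast
  moreover have "((a, b) \<in> R) \<noteq> ((b, a) \<in> R)" if "(a, b) \<in> parcs G" for a b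
  proof -
    have UV: "((u, v) \<in> R) \<noteq> ((v, u) \<in> R)" if "u \<in> {x1, x2, x3}" "v \<in> V" for u v
    proof -
      have "v \<notin> {x1, x2, x3}" "v \<notin> W" using that disj by blast+
      then show ?thesis using that ne nonmem by (elim insertE emptyE) (simp_all add: R_def not_le)
    qed
    have UW: "((u, w) \<in> R) \<noteq> ((w, u) \<in> R)" if "u \<in> {x1, x2, x3}" "w \<in> W" for u w
    proof -
      have "w \<notin> {x1, x2, x3}" "w \<notin> V" using that disj by blast+
      then show ?thesis using that ne nonmem by (elim insertE emptyE) (simp_all add: R_def)
    qed
    have VW: "((v, w) \<in> R) \<noteq> ((w, v) \<in> R)" if "v \<in> V" "w \<in> W" for v w
    proof -
      have "v \<notin> {x1, x2, x3}" "w \<notin> {x1, x2, x3}" "v \<notin> W" "w \<notin> V" using that disj by blast+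
      then show ?thesis using that by (simp add: R_def)
    qed
    show ?thesis using \<open>(a, b) \<in> parcs G\<close> UV UW VW unfolding arcs by blast
  qed
  ultimately have "orientation D G"
    unfolding orientation_iff[OF \<open>pair_graph G\<close>] D_def by auto
  define T where "T = R \<union> R O R"
  have two: "(a, b) \<in> T" if "a \<in> pverts G" "b \<in> pverts G" "a \<noteq> b" for a b
  proof -
    have via: "(u, v) \<in> T" if "(u, z) \<in> R" "(z, v) \<in> R" for u z v
      using that by (auto simp: T_def)
    have arc: "(u, v) \<in> T" if "(u, v) \<in> R" for u v
      using that by (simp add: T_def)
    have UU: "(x1, x2) \<in> T" "(x1, x3) \<in> T" "(x2, x1) \<in> T"
      "(x2, x3) \<in> T" "(x3, x1) \<in> T" "(x3, x2) \<in> T"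
      using via[of x1 v1 x2] via[of x1 v1 x3] via[of x2 w1 x1] via[of x2 v0 x3] via[of x3 w1 x1]
        via[of x3 w2 x2] R v0 v1 w1 w2 by simp_all
    have UV: "(x1, v) \<in> T" "(v, x1) \<in> T" "(x2, v) \<in> T" "(v, x2) \<in> T" "(x3, v) \<in> T" "(v, x3) \<in> T"
      if v: "v \<in> V" for v
    proof -
      show "(x1, v) \<in> T" "(v, x3) \<in> T" using arc R(1,2) v by auto
      obtain w where "w \<in> W" "g v \<notin> h w" using omit v by blast
      then show "(v, x1) \<in> T" using via[of v w x1] R(6,10) v by simp
      obtain w where "w \<in> W" "g v \<in> h w" using hit v by blast
      then show "(x3, v) \<in> T" using via[of x3 w v] R(5,9) v by simp
      show "(x2, v) \<in> T"
      proof (cases "g v < k")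
        case True
        then show ?thesis using arc R(3) v by simp
      next
        case False
        then obtain w where "w \<in> W" "p \<notin> h w" "g v \<in> h w" using highW v by (meson not_le)
        then show ?thesis using via[of x2 w v] R(8,9) v by simp
      qed
      show "(v, x2) \<in> T"
      proof (cases "g v < k")
        case True
        then have "g v \<notin> h w2" using w2(3) by blast
        then show ?thesis using via[of v w2 x2] R(7,10) v w2 by simp
      next
        case False
        then show ?thesis using arc R(4) v by simp
      qed
    qed
    have UW: "(x1, w) \<in> T" "(w, x1) \<in> T" "(x2, w) \<in> T" "(w, x2) \<in> T" "(x3, w) \<in> T" "(w, x3) \<in> T"
      if w: "w \<in> W" for w
    proof -
      show "(x3, w) \<in> T" "(w, x1) \<in> T" using arc R(5,6) w by auto
      obtain v where "v \<in> V" "g v \<notin> h w" using out_any w by blast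
      then show "(x1, w) \<in> T" using via[of x1 v w] R(1,10) w by simp
      obtain v where "v \<in> V" "g v \<in> h w" using in_any w by blast
      then show "(w, x3) \<in> T" using via[of w v x3] R(2,9) w by simp
      show "(x2, w) \<in> T"
      proof (cases "p \<in> h w")
        case True
        then obtain v where "v \<in> V" "g v < k" "g v \<notin> h w" using out_low w by blast
        then show ?thesis using via[of x2 v w] R(3,10) w by simp
      next
        case False
        then show ?thesis using arc R(8) w by simp
      qed
      show "(w, x2) \<in> T"
      proof (cases "p \<in> h w")
        case True
        then show ?thesis using arc R(7) w by simp
      next
        case False
        then obtain v where "v \<in> V" "k \<le> g v" "g v \<in> h w" using in_high w by blast
        then show ?thesis using via[of w v x2] R(4,9) w by simp
      qed
    qed
    have VV: "(u, v) \<in> T" if uv: "u \<in> V" "v \<in> V" "u \<noteq> v" for u v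
    proof (cases "g u < k \<or> k \<le> g v")
      case True
      then obtain w where "w \<in> W" "g u \<notin> h w" "g v \<in> h w" using sepW uv by blast
      then show ?thesis using via[of u w v] R(9,10) uv by simp
    next
      \<comment> \<open>Here \<open>k \<le> g u\<close> and \<open>g v < k\<close>, the case not
        covered by \<open>sep\<close>; \<open>x2\<close> is the midpoint.\<close>
      case False
      then show ?thesis using via[of u x2 v] R(3,4) uv by simp
    qed
    \<comment> \<open>\<open>x3\<close> and \<open>x1\<close> are hubs: all of \<open>V\<close>
      points to \<open>x3\<close>, which points to all of \<open>W\<close>; all of \<open>W\<close>
      points to \<open>x1\<close>, which points to all of \<open>V\<close>.\<close>
    have VW: "(v, w) \<in> T" "(w, v) \<in> T" if vw: "v \<in> V" "w \<in> W" for v w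
      using via[of v x3 w] via[of w x1 v] R(1,2,5,6) vw by simp_all
    have WW: "(w, w') \<in> T" if "w \<in> W" "w' \<in> W" "w \<noteq> w'" for w w'
      using diffW[OF that] via by blast
    have "a \<in> {x1, x2, x3} \<or> a \<in> V \<or> a \<in> W" "b \<in> {x1, x2, x3} \<or> b \<in> V \<or> b \<in> W"
      using \<open>a \<in> pverts G\<close> \<open>b \<in> pverts G\<close> verts by auto
    then show ?thesis
      using \<open>a \<noteq> b\<close>
      by (elim disjE insertE emptyE) (simp_all only: UU UV UW VV VW WW simp_thms not_False_eq_True)
  qed
  have "R \<subseteq> pverts G \<times> pverts G" by (auto simp: R_def verts)
  then have "strongly_connected (with_proj D)" "diameter (with_proj D) \<le> 2"
    using two_step_distance[of D] two[unfolded T_def] verts by (auto simp: D_def)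
  with \<open>orientation D G\<close> show ?thesis by (auto simp: strong_orientation_def)
qed

section \<open>The oriented diameter of the complete tripartite graph\<close>

theorem theorem5p10:
  fixes p q :: nat and G :: "'a pair_pre_digraph"
  assumes "complete_tripartite_digraph 3 p q (with_proj G)"
    and "5 \<le> p" and "p \<le> q" and "q \<le> ((p + 1) choose ((p + 1) div 2)) - 1"
  shows "oriented_diameter G = 2"
proof -
  obtain U V W where G: "graph (with_proj G)" "pverts G = U \<union> V \<union> W"
    and disj: "U \<inter> V = {}" "U \<inter> W = {}" "V \<inter> W = {}"
    and card: "card U = 3" "card V = p" "card W = q"
    and arcs: "parcs G = U \<times> V \<union> V \<times> U \<union> U \<times> W \<union> W \<times> U \<union> V \<times> W \<union> W \<times> V"
    using assms(1) unfolding complete_tripartite_digraph_def with_proj_simps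
    by (elim conjE exE) (rule that)
  have "pair_graph G" using G(1) by (rule pair_graphI_graph)
  obtain x1 x2 x3 where U: "U = {x1, x2, x3}" "distinct [x1, x2, x3]"
  proof -
    obtain x1 x2 x3 where "U = {x1, x2, x3}" "x1 \<noteq> x2" "x2 \<noteq> x3" "x1 \<noteq> x3"
      using card(1) unfolding card_3_iff by blast
    then show thesis by (intro that[of x1 x2 x3]) simp_all
  qed
  \<comment> \<open>Infinite sets have \<open>card\<close> 0, so positive cardinality yields the
    finiteness needed for the bijections \<open>g\<close> and \<open>h\<close>.\<close>
  have "0 < card V" "0 < card W" using card assms(2,3) by simp_all
  then have "finite V" "finite W" by (simp_all add: card_ge_0_finite)
  have "2 \<le> p" using assms(2) by simp
  have "\<exists>D. strong_orientation D G \<and> diameter (with_proj D) \<le> 2"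
  proof (rule separating_family[OF \<open>2 \<le> p\<close> assms(3,4)])
    fix F :: "nat set set"
    let ?k = "(p + 1) div 2"
    assume "finite F" "card F = q"
      and F: "\<And>X. X \<in> F \<Longrightarrow> X \<subseteq> {..p} \<and> card X = ?k \<and> X \<noteq> {..<?k}"
      "\<And>u v. u < p \<Longrightarrow> v < p \<Longrightarrow> u \<noteq> v \<Longrightarrow> u < ?k \<or> ?k \<le> v \<Longrightarrow> \<exists>X\<in>F. u \<notin> X \<and> v \<in> X"
      "\<And>v. ?k \<le> v \<Longrightarrow> v < p \<Longrightarrow> \<exists>X\<in>F. p \<notin> X \<and> v \<in> X"
      "\<exists>X\<in>F. p \<in> X \<and> X \<inter> {..<?k} = {}"
    obtain g where g: "bij_betw g V {..<p}"
      using finite_same_card_bij[OF \<open>finite V\<close> finite_lessThan, of p] card(2) by auto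
    obtain h where h: "bij_betw h W F"
      using finite_same_card_bij[OF \<open>finite W\<close> \<open>finite F\<close>] \<open>card F = q\<close> card(3) by auto
    have k: "2 \<le> ?k" "?k + 1 < p" using assms(2) by simp_all
    show ?thesis
      by (rule strong_orientation_of_family[OF \<open>pair_graph G\<close> G(2)[unfolded U(1)] U(2)
            disj[unfolded U(1)] arcs[unfolded U(1)] g h k F])
  qed
  then obtain D where D: "strong_orientation D G" "diameter (with_proj D) \<le> 2" by blast
  have "2 \<le> diameter (with_proj D')" if "strong_orientation D' G" for D'
  proof -
    have D': "pverts D' = pverts G" "parcs D' \<subseteq> parcs G"
      using that orientation_iff[OF \<open>pair_graph G\<close>] by (auto simp: strong_orientation_def)
    \<comment> \<open>Two vertices of one part are not adjacent in \<open>G\<close>, hence at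
      distance at least 2 in every orientation.\<close>
    have "x1 \<in> U" "x2 \<in> U" "x1 \<noteq> x2" using U by simp_all
    moreover have "(x1, x2) \<notin> parcs G" using calculation disj by (simp add: arcs disjoint_iff)
    ultimately show ?thesis using D' G(2) by (intro two_le_diameter[of x1 D' x2]) auto
  qed
  then have "2 \<le> oriented_diameter G"
    unfolding oriented_diameter_def by (intro INF_greatest) simp
  moreover have "oriented_diameter G \<le> 2"
    unfolding oriented_diameter_def using D by (intro INF_lower2[of D]) simp_all
  ultimately show ?thesis by (intro antisym)
qed

end
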